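(* Let $g$ be a $g$-function on a finite alphabet $A$. Suppose that $g\geq\epsilon$ for some $\epsilon>0$ and that the set $\mathcal{D}_g$ of discontinuities of $g$ is countable. Then $\mathcal{M}_T(g)\neq\emptyset$.
   Context: $A$ is a finite (nonempty) alphabet with the discrete topology, $\mathcal{X}=A^{\mathbb{Z}}$, $\mathcal{X}^-=A^{\{\ldots,-2,-1\}}$ (pasts), $\mathcal{X}^{\le 0}=A^{\{\ldots,-1,0\}}$, all with product topologies; $\mathcal{F}^{\le 0}$ and $\mathcal{F}^-$ are the $\sigma$-algebras generated by the coordinates of index $\le 0$ and $\le -1$. For $x\in\mathcal{X}$, $\underline x=\ldots x_{-2}x_{-1}$. $T$ is the shift $(Tx)_n=x_{n+1}$, and $[a]_0=\{x: x_0=a\}$. A $g$-function is an $\mathcal{F}^{\le 0}$-measurable $g:\mathcal{X}^{\le 0}\to[0,1]$ with $\sum_{a\in A}g(\underline x a)=1$ for all $\underline x\in\mathcal{X}^-$, where $\underline x a$ is concatenation. $g$ is continuous at $\underline x\in\mathcal{X}^-$ if $g(\underline x^{(k)}a)\to g(\underline x a)$ for every $a\in A$ and every sequence $\underline x^{(k)}\to\underline x$ in $\mathcal{X}^-$; $\mathcal{D}_g\subset\mathcal{X}^-$ is the set of pasts at which $g$ is not continuous. $\mathcal{M}_T(g)$ is the set of shift-invariant Borel probability measures $\mu$ on $\mathcal{X}$ compatible with $g$, i.e. such that for every $a\in A$, $\mathbb{E}_\mu(\mathbf 1_{[a]_0}\mid\mathcal{F}^-)(x)=g(\underline x a)$ for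 $\mu$-a.e. $x$. *)

theory Defs
  imports "HOL-Probability.Probability"
begin

text \<open>
  The alphabet is a type \<open>'a\<close> of class \<open>finite\<close>. Bi-infinite sequences are total functions
  \<open>int \<Rightarrow> 'a\<close>. A sequence indexed by \<open>{..n}\<close> is an element of \<open>{..n} \<rightarrow>\<^sub>E UNIV\<close>, that is, a function
  on \<open>int\<close> that is \<open>undefined\<close> outside \<open>{..n}\<close>; these are the points of the library's
  \<open>product_topology _ {..n}\<close> and \<open>PiM {..n} _\<close>.
\<close>

definition seq_topology :: "int set \<Rightarrow> (int \<Rightarrow> 'a::finite) topology" where
  "seq_topology I = product_topology (\<lambda>_. discrete_topology UNIV) I"

definition pasts :: "(int \<Rightarrow> 'a::finite) set" where
  "pasts = {..-1} \<rightarrow>\<^sub>E UNIV"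

definition pasts0 :: "(int \<Rightarrow> 'a::finite) set" where
  "pasts0 = {..0} \<rightarrow>\<^sub>E UNIV"

definition past_of :: "(int \<Rightarrow> 'a::finite) \<Rightarrow> (int \<Rightarrow> 'a)" where
  "past_of x = restrict x {..-1}"

definition append0 :: "(int \<Rightarrow> 'a::finite) \<Rightarrow> 'a \<Rightarrow> (int \<Rightarrow> 'a)" where
  "append0 x a = x(0 := a)"

definition shift :: "(int \<Rightarrow> 'a::finite) \<Rightarrow> (int \<Rightarrow> 'a)" where
  "shift x = (\<lambda>n. x (n + 1))"

definition seq_borel :: "(int \<Rightarrow> 'a::finite) measure" where
  "seq_borel = sigma UNIV {U. openin (seq_topology UNIV) U}"

text \<open>The \<open>\<sigma>\<close>-algebra on bi-infinite sequences generated by the coordinates of index at most \<open>n\<close>.\<close>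

definition coord_algebra :: "int \<Rightarrow> (int \<Rightarrow> 'a::finite) measure" where
  "coord_algebra n = sigma UNIV {{x. x i \<in> B} | i B. i \<le> n}"

text \<open>
  On sequences indexed by \<open>{..0}\<close>, the \<open>\<sigma>\<close>-algebra generated by the coordinates is the
  product \<open>\<sigma>\<close>-algebra.
\<close>

definition g_function :: "((int \<Rightarrow> 'a::finite) \<Rightarrow> real) \<Rightarrow> bool" where
  "g_function g \<longleftrightarrow>
     g \<in> borel_measurable (PiM {..0} (\<lambda>_. count_space UNIV)) \<and>
     (\<forall>y\<in>pasts0. 0 \<le> g y \<and> g y \<le> 1) \<and>
     (\<forall>x\<in>pasts. (\<Sum>a\<in>UNIV. g (append0 x a)) = 1)"

definition g_continuous_at :: "((int \<Rightarrow> 'a::finite) \<Rightarrow> real) \<Rightarrow> (int \<Rightarrow> 'a) \<Rightarrow> bool" where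
  "g_continuous_at g x \<longleftrightarrow>
     (\<forall>a. \<forall>xs. (\<forall>k::nat. xs k \<in> pasts) \<and> limitin (seq_topology {..-1}) xs x sequentially \<longrightarrow>
        (\<lambda>k. g (append0 (xs k) a)) \<longlonglongrightarrow> g (append0 x a))"

definition discontinuities :: "((int \<Rightarrow> 'a::finite) \<Rightarrow> real) \<Rightarrow> (int \<Rightarrow> 'a) set" where
  "discontinuities g = {x \<in> pasts. \<not> g_continuous_at g x}"

definition compatible :: "((int \<Rightarrow> 'a::finite) \<Rightarrow> real) \<Rightarrow> (int \<Rightarrow> 'a) measure \<Rightarrow> bool" where
  "compatible g \<mu> \<longleftrightarrow>
     (\<forall>a. AE x in \<mu>. real_cond_exp \<mu> (coord_algebra (-1)) (indicator {y. y 0 = a}) x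
                      = g (append0 (past_of x) a))"

definition invariant_g_measures :: "((int \<Rightarrow> 'a::finite) \<Rightarrow> real) \<Rightarrow> (int \<Rightarrow> 'a) measure set" where
  "invariant_g_measures g =
     {\<mu>. prob_space \<mu> \<and> sets \<mu> = sets seq_borel \<and> distr \<mu> \<mu> shift = \<mu> \<and> compatible g \<mu>}"

text \<open>
  \<open>real_cond_exp\<close> and \<open>distr\<close> take junk values when the conditioning algebra is not a
  subalgebra and when the map is not measurable, respectively; \<open>subalgebra_coord_algebra\<close> and
  \<open>measurable_shift\<close> exclude both.
\<close>

lemma topspace_seq_topology [simp]: "topspace (seq_topology I) = I \<rightarrow>\<^sub>E UNIV"
  by (simp add: seq_topology_def)

lemma space_seq_borel [simp]: "space seq_borel = UNIV"
  by (simp add: seq_borel_def space_measure_of_conv)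

lemma continuous_map_coordinate:
  "continuous_map (seq_topology UNIV) (discrete_topology UNIV) (\<lambda>x. x i)"
  unfolding seq_topology_def by (rule continuous_map_product_projection) simp

lemma coordinate_event_in_seq_borel: "{x. x i \<in> B} \<in> sets seq_borel"
proof -
  have "openin (seq_topology UNIV) {x \<in> topspace (seq_topology UNIV). x i \<in> B}"
    by (rule openin_continuous_map_preimage[OF continuous_map_coordinate]) simp
  then have "openin (seq_topology UNIV) {x. x i \<in> B}" by simp
  then show ?thesis
    by (auto simp: seq_borel_def sets_measure_of_conv)
qed

lemma subalgebra_coord_algebra:
  assumes "sets \<mu> = sets seq_borel"
  shows "subalgebra \<mu> (coord_algebra n)"
proof -
  have "sigma_sets UNIV {{x. x i \<in> B} | i B. i \<le> n} \<subseteq> sets seq_borel"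
    using sets.sigma_sets_subset[of "{{x. x i \<in> B} | i B. i \<le> n}" seq_borel]
      coordinate_event_in_seq_borel by auto
  then show ?thesis
    using assms sets_eq_imp_space_eq[OF assms]
    by (auto simp: subalgebra_def coord_algebra_def space_measure_of_conv sets_measure_of_conv)
qed

lemma continuous_map_shift:
  "continuous_map (seq_topology UNIV) (seq_topology UNIV) (shift :: (int \<Rightarrow> 'a::finite) \<Rightarrow> _)"
proof -
  have "continuous_map (seq_topology UNIV) (product_topology (\<lambda>_. discrete_topology UNIV) UNIV)
      (shift :: (int \<Rightarrow> 'a) \<Rightarrow> _)"
    unfolding continuous_map_componentwise_UNIV
    by (simp add: shift_def continuous_map_coordinate)
  then show ?thesis
    by (simp add: seq_topology_def)
qed

lemma measurable_shift:
  fixes \<mu> :: "(int \<Rightarrow> 'a::finite) measure"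
  assumes "sets \<mu> = sets seq_borel"
  shows "shift \<in> measurable \<mu> \<mu>"
proof -
  have "(shift :: (int \<Rightarrow> 'a) \<Rightarrow> _) \<in> measurable seq_borel (sigma UNIV {U. openin (seq_topology UNIV) U})"
  proof (rule measurable_measure_of)
    fix U :: "(int \<Rightarrow> 'a) set" assume "U \<in> {U. openin (seq_topology UNIV) U}"
    then have "openin (seq_topology UNIV) {x \<in> topspace (seq_topology UNIV). shift x \<in> U}"
      by (intro openin_continuous_map_preimage[OF continuous_map_shift]) auto
    then show "shift -` U \<inter> space seq_borel \<in> sets seq_borel"
      by (auto simp: seq_borel_def sets_measure_of_conv space_measure_of_conv vimage_def)
  qed auto
  then show ?thesis
    using assms measurable_cong_sets unfolding seq_borel_def by blast
qed

end

theory Submission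
  imports Defs
begin

text \<open>
  Run the process with transition probabilities \<open>g\<close> from an arbitrary past and take a limit point of
  its Cesaro averages along the shift. The limit is shift-invariant; the question is whether it is
  still compatible with \<open>g\<close>, and it is if the limit measure gives no mass to the sequences whose
  past is a discontinuity. If there are two letters, \<open>g \<ge> \<epsilon>\<close> forces \<open>g \<le> 1 - \<epsilon>\<close>, so the process gives
  a word of length \<open>k\<close> probability at most \<open>(1 - \<epsilon>) ^ k\<close>, and so does the limit. Hence every single
  past has measure zero, and therefore so has every countable set of pasts. If there is only one
  letter, \<open>g\<close> has no discontinuity.

  The limit is taken in two stages. First, along a suitable filter (lemma
  \<open>bounded_sequences_converge_along_filter\<close>), the averages converge on all bounded functions. The
  result is a mean \<open>\<Lambda>\<close>, a finitely additive expectation, which is exactly invariant and satisfies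
  \<open>\<Lambda> (1\<^bsub>[a]\<^esub> f) = \<Lambda> (g(_ a) f)\<close> for every bounded \<open>f\<close> that depends on negative coordinates (lemma
  \<open>g_mean_exists\<close>). Second, the values of \<open>\<Lambda>\<close> on cylinders extend to a countably additive measure
  \<open>\<mu>\<close> (lemma \<open>mean_represented_by_measure\<close>). Here continuity enters: a bounded measurable function
  has \<open>\<mu>\<close>-integral equal to its \<open>\<Lambda>\<close>-mean if it is continuous \<open>\<mu>\<close>-almost everywhere (lemma
  \<open>mean_eq_integral\<close>). Applied to \<open>g\<close> times the indicator of a cylinder, this turns the equation for
  \<open>\<Lambda>\<close> into the defining equation of the conditional expectation under \<open>\<mu>\<close>.
\<close>

section \<open>Generalised limits\<close>

text \<open>
  By Tychonoff's theorem, the sequence of the evaluation functionals \<open>u \<mapsto> u n\<close> has a cluster point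
  in the product, over all bounded sequences \<open>u\<close>, of the closures of their ranges; restricting
  \<open>sequentially\<close> to the neighbourhoods of this cluster point gives the filter. One filter serves
  uncountably many sequences at once, which no subsequence would do; and limits along a filter are
  linear and monotone, so they can be used like limits of sequences.
\<close>

lemma bounded_sequences_converge_along_filter:
  obtains G :: "nat filter" where "G \<le> sequentially" "G \<noteq> bot"
    "\<And>u :: nat \<Rightarrow> real. bounded (range u) \<Longrightarrow> \<exists>l. (u \<longlongrightarrow> l) G"
proof -
  (* Unbounded sequences are indices too; their factor is the single point 0. *)
  define box where "box u = (if bounded (range u) then closure (range u) else {0})"
    for u :: "nat \<Rightarrow> real"
  define \<phi> where "\<phi> n u = (if bounded (range u) then u n else 0)" for n and u :: "nat \<Rightarrow> real"
  have "compactin (product_topology (\<lambda>_. euclidean) UNIV) (PiE UNIV box)"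
    unfolding compactin_PiE by (auto simp: box_def compact_closure)
  then have "compact (PiE UNIV box)"
    by (simp add: euclidean_product_topology)
  moreover have "\<phi> n \<in> PiE UNIV box" for n
    by (auto simp: \<phi>_def box_def PiE_UNIV_domain intro!: subsetD[OF closure_subset])
  then have "eventually (\<lambda>v. v \<in> PiE UNIV box) (filtermap \<phi> sequentially)"
    by (simp add: eventually_filtermap)
  moreover have "filtermap \<phi> sequentially \<noteq> bot"
    by (simp add: filtermap_bot_iff)
  ultimately obtain l where l: "inf (nhds l) (filtermap \<phi> sequentially) \<noteq> bot"
    unfolding compact_filter by blast
  define G where "G = inf sequentially (filtercomap \<phi> (nhds l))"
  have "filterlim \<phi> (nhds l) G"
    unfolding G_def filterlim_def
    by (meson filtermap_filtercomap filtermap_mono inf_le2 order_trans)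
  then have lim: "((\<lambda>n. \<phi> n u) \<longlongrightarrow> l u) G" for u
    by (rule continuous_on_tendsto_compose[OF continuous_on_product_coordinates]) auto
  show ?thesis
  proof
    show "G \<le> sequentially"
      by (simp add: G_def)
    show "G \<noteq> bot"
    proof
      assume "G = bot"
      then have "eventually (\<lambda>_. False) (inf sequentially (filtercomap \<phi> (nhds l)))"
        by (simp add: G_def)
      then obtain P R where P: "eventually P sequentially"
        and R: "eventually R (filtercomap \<phi> (nhds l))" and PR: "\<And>n. P n \<Longrightarrow> R n \<Longrightarrow> False"
        unfolding eventually_inf by auto
      obtain Q where Q: "eventually Q (nhds l)" "\<And>n. Q (\<phi> n) \<Longrightarrow> R n"
        using R unfolding eventually_filtercomap by auto
      have "eventually (\<lambda>v. \<not> Q v) (filtermap \<phi> sequentially)"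
        unfolding eventually_filtermap using P PR Q(2) by (auto elim!: eventually_mono)
      then have "eventually (\<lambda>_. False) (inf (nhds l) (filtermap \<phi> sequentially))"
        unfolding eventually_inf using Q(1) by (intro exI[of _ Q] exI[of _ "\<lambda>v. \<not> Q v"]) simp
      with l show False
        by (simp add: trivial_limit_def)
    qed
    show "\<exists>l. (u \<longlongrightarrow> l) G" if "bounded (range u)" for u :: "nat \<Rightarrow> real"
      using lim[of u] that by (auto simp: \<phi>_def)
  qed
qed

section \<open>Finitely additive means\<close>

text \<open>
  An expectation for a finitely additive probability that is defined on all sets. The process below
  starts at an arbitrary point and \<open>g\<close> is only partly continuous, so a limit of its averages that is
  tested on continuous functions can lose the defining equation of a \<open>g\<close>-measure; a limit that
  is tested on all bounded functions keeps it, at the price of countable additivity.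
\<close>

locale mean =
  fixes \<Lambda> :: "('x \<Rightarrow> real) \<Rightarrow> real"
  assumes add: "bounded (range f) \<Longrightarrow> bounded (range h) \<Longrightarrow> \<Lambda> (\<lambda>x. f x + h x) = \<Lambda> f + \<Lambda> h"
    and scale: "bounded (range f) \<Longrightarrow> \<Lambda> (\<lambda>x. c * f x) = c * \<Lambda> f"
    and mono: "bounded (range f) \<Longrightarrow> bounded (range h) \<Longrightarrow> (\<And>x. f x \<le> h x) \<Longrightarrow> \<Lambda> f \<le> \<Lambda> h"
    and one: "\<Lambda> (\<lambda>x. 1) = 1"
begin

lemma zero: "\<Lambda> (\<lambda>x. 0) = 0"
  using scale[of "\<lambda>x. 0" 0] by (simp add: image_constant_conv)

lemma nonneg: "bounded (range f) \<Longrightarrow> (\<And>x. 0 \<le> f x) \<Longrightarrow> 0 \<le> \<Lambda> f"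
  using mono[of "\<lambda>x. 0" f] zero by (simp add: image_constant_conv)

lemma uminus: "bounded (range f) \<Longrightarrow> \<Lambda> (\<lambda>x. - f x) = - \<Lambda> f"
  using scale[of f "-1"] by simp

end

lemma bounded_range_indicator: "bounded (range (indicator A :: 'x \<Rightarrow> real))"
  by (intro boundedI[of _ 1]) (auto simp: indicator_def)

lemma bounded_range_mult:
  fixes f h :: "'x \<Rightarrow> real"
  assumes "bounded (range f)" "bounded (range h)"
  shows "bounded (range (\<lambda>x. f x * h x))"
proof -
  obtain a b where "\<And>x. \<bar>f x\<bar> \<le> a" "\<And>x. \<bar>h x\<bar> \<le> b"
    using assms by (auto simp: bounded_real)
  then have "\<bar>f x * h x\<bar> \<le> a * b" for x
    by (simp add: abs_mult mult_mono')
  then show ?thesis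
    by (intro boundedI[of _ "a * b"]) auto
qed

lemma bounded_range_add:
  fixes f h :: "'x \<Rightarrow> real"
  assumes "bounded (range f)" "bounded (range h)"
  shows "bounded (range (\<lambda>x. f x + h x))"
  by (rule bounded_plus_comp) (use assms in auto)

context mean
begin

lemma finite_sum:
  assumes "finite I" "\<And>i. i \<in> I \<Longrightarrow> bounded (range (f i))"
  shows "\<Lambda> (\<lambda>x. \<Sum>i\<in>I. f i x) = (\<Sum>i\<in>I. \<Lambda> (f i)) \<and> bounded (range (\<lambda>x. \<Sum>i\<in>I. f i x))"
  using assms
proof (induction I rule: finite_induct)
  case empty
  then show ?case by (simp add: zero image_constant_conv)
next
  case (insert j I)
  then show ?case
    by (simp add: add bounded_range_add)
qed

end

section \<open>The stopped process\<close>

text \<open>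
  \<open>g\<close> as a function on bi-infinite sequences: the probability that the letter at \<open>0\<close> is \<open>a\<close>, given
  the coordinates of negative index.
\<close>

definition g_weight :: "((int \<Rightarrow> 'a::finite) \<Rightarrow> real) \<Rightarrow> 'a \<Rightarrow> (int \<Rightarrow> 'a) \<Rightarrow> real" where
  "g_weight g a x = g (append0 (past_of x) a)"

text \<open>
  The expectation of \<open>h\<close> under the process that starts from the sequence \<open>z\<close> and replaces the
  coordinates \<open>0, \<dots>, n - 1\<close> one after the other by letters that are drawn according to \<open>g\<close>; the
  later coordinates keep their values in \<open>z\<close>. It is a sum over finitely many words, so it makes sense for
  every \<open>h\<close>.
\<close>

primrec stopped_exp ::
    "((int \<Rightarrow> 'a::finite) \<Rightarrow> real) \<Rightarrow> (int \<Rightarrow> 'a) \<Rightarrow> nat \<Rightarrow> ((int \<Rightarrow> 'a) \<Rightarrow> real) \<Rightarrow> real" where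
  "stopped_exp g z 0 h = h z"
| "stopped_exp g z (Suc n) h =
     stopped_exp g z n (\<lambda>x. \<Sum>a\<in>UNIV. g_weight g a ((shift ^^ n) x) * h (x(int n := a)))"

lemma shift_power: "(shift ^^ n) x i = x (i + int n)"
proof (induction n arbitrary: i)
  case (Suc n)
  then show ?case by (simp add: shift_def add.assoc)
qed simp

lemma append0_past_of_in_pasts0: "append0 (past_of x) a \<in> pasts0"
  unfolding pasts0_def append0_def past_of_def PiE_iff extensional_def
  by (intro conjI CollectI allI impI ballI UNIV_I) simp

lemma past_of_in_pasts: "past_of x \<in> pasts"
  by (simp add: pasts_def past_of_def)

lemma
  assumes "g_function g"
  shows g_weight_nonneg: "0 \<le> g_weight g a x"
    and g_weight_le_1: "g_weight g a x \<le> 1"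
    and sum_g_weight: "(\<Sum>a\<in>UNIV. g_weight g a x) = 1"
proof -
  have "\<forall>y\<in>pasts0. 0 \<le> g y \<and> g y \<le> 1" "\<forall>x\<in>pasts. (\<Sum>a\<in>UNIV. g (append0 x a)) = 1"
    using assms unfolding g_function_def by auto
  from bspec[OF this(1) append0_past_of_in_pasts0, of x a] bspec[OF this(2) past_of_in_pasts, of x]
  show "0 \<le> g_weight g a x" "g_weight g a x \<le> 1" "(\<Sum>a\<in>UNIV. g_weight g a x) = 1"
    unfolding g_weight_def by simp_all
qed

lemma bounded_range_g_weight: "g_function g \<Longrightarrow> bounded (range (g_weight g a))"
  by (intro boundedI[of _ 1]) (auto simp: g_weight_nonneg g_weight_le_1)

lemma g_weight_cong: "past_of x = past_of y \<Longrightarrow> g_weight g a x = g_weight g a y"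
  by (simp add: g_weight_def)

lemma stopped_exp_add:
  "stopped_exp g z n (\<lambda>x. f x + h x) = stopped_exp g z n f + stopped_exp g z n h"
proof (induction n arbitrary: f h)
  case (Suc n)
  have "(\<Sum>a\<in>UNIV. g_weight g a ((shift ^^ n) x) * (f (x(int n := a)) + h (x(int n := a)))) =
      (\<Sum>a\<in>UNIV. g_weight g a ((shift ^^ n) x) * f (x(int n := a))) +
      (\<Sum>a\<in>UNIV. g_weight g a ((shift ^^ n) x) * h (x(int n := a)))" for x
    by (simp add: distrib_left sum.distrib)
  then show ?case by (simp only: stopped_exp.simps Suc.IH)
qed simp

lemma stopped_exp_scale:
  "stopped_exp g z n (\<lambda>x. c * f x) = c * stopped_exp g z n f"
proof (induction n arbitrary: f)
  case (Suc n)
  have "(\<Sum>a\<in>UNIV. g_weight g a ((shift ^^ n) x) * (c * f (x(int n := a)))) =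
      c * (\<Sum>a\<in>UNIV. g_weight g a ((shift ^^ n) x) * f (x(int n := a)))" for x
    by (simp add: sum_distrib_left algebra_simps)
  then show ?case by (simp only: stopped_exp.simps Suc.IH)
qed simp

lemma stopped_exp_mono:
  assumes "g_function g"
  shows "(\<And>x. f x \<le> h x) \<Longrightarrow> stopped_exp g z n f \<le> stopped_exp g z n h"
proof (induction n arbitrary: f h)
  case (Suc n)
  show ?case
    unfolding stopped_exp.simps
    by (intro Suc.IH sum_mono mult_left_mono Suc.prems g_weight_nonneg[OF assms])
qed simp

text \<open>
  From step \<open>m\<close> on, the process only overwrites coordinates of index at least \<open>m\<close>, with weights of
  sum \<open>1\<close>; a function that ignores these coordinates has its final expectation after \<open>m\<close> steps.
\<close>

lemma stopped_exp_stable: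
  assumes g: "g_function g" and f: "\<And>x i a. int m \<le> i \<Longrightarrow> f (x(i := a)) = f x" and "m \<le> n"
  shows "stopped_exp g z n f = stopped_exp g z m f"
  using \<open>m \<le> n\<close>
proof (induction n rule: dec_induct)
  case (step n)
  then have "stopped_exp g z (Suc n) f =
      stopped_exp g z n (\<lambda>x. \<Sum>a\<in>UNIV. g_weight g a ((shift ^^ n) x) * f x)"
    by (simp add: f)
  also have "\<dots> = stopped_exp g z n f"
    by (simp add: sum_distrib_right[symmetric] sum_g_weight[OF g])
  finally show ?case using step by simp
qed simp

lemma stopped_exp_const: "g_function g \<Longrightarrow> stopped_exp g z n (\<lambda>x. c) = c"
  using stopped_exp_stable[of g 0 "\<lambda>x. c" n z] by simp

text \<open>
  The conditional law of the letter at \<open>j\<close> given the coordinates before \<open>j\<close> is exactly \<open>g\<close>, as soon as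
  step \<open>j\<close> has been made: by \<open>stopped_exp_stable\<close> both sides can be evaluated at that time.
\<close>

lemma stopped_exp_step:
  assumes g: "g_function g" and "j < n"
  shows "stopped_exp g z n (\<lambda>x. indicator {y. y 0 = a} ((shift ^^ j) x) * f (past_of ((shift ^^ j) x)))
    = stopped_exp g z n (\<lambda>x. g_weight g a ((shift ^^ j) x) * f (past_of ((shift ^^ j) x)))"
    (is "stopped_exp g z n ?l = stopped_exp g z n ?r")
proof -
  have past: "past_of ((shift ^^ j) (x(i := b))) = past_of ((shift ^^ j) x)"
    if "int j \<le> i" for x :: "int \<Rightarrow> 'a" and i b
    using that by (auto simp: past_of_def shift_power restrict_def)
  have tr: "g_weight g a ((shift ^^ j) (x(i := b))) = g_weight g a ((shift ^^ j) x)"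
    if "int j \<le> i" for x :: "int \<Rightarrow> 'a" and i b
    by (rule g_weight_cong[OF past[OF that]])
  have "stopped_exp g z n ?l = stopped_exp g z (Suc j) ?l"
    using \<open>j < n\<close> by (intro stopped_exp_stable[OF g]) (auto simp: past shift_power indicator_def)
  also have "\<dots> = stopped_exp g z j ?r"
  proof -
    have "g_weight g b w * (indicator {y. y 0 = a} ((shift ^^ j) (x(int j := b))) * c)
        = (if b = a then g_weight g a w * c else 0)" for b x w and c :: real
      by (simp add: shift_power indicator_def)
    then show ?thesis
      by (simp add: past)
  qed
  also have "\<dots> = stopped_exp g z n ?r"
    using \<open>j < n\<close> by (intro stopped_exp_stable[OF g, symmetric]) (simp_all add: past tr)
  finally show ?thesis .
qed

text \<open>
  Averaging over the shifts by less than \<open>n\<close> while running exactly \<open>n\<close> steps makes each averaged term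
  see the origin at a time where the process has already chosen the letter by \<open>g\<close>. So the defining
  equation of a \<open>g\<close>-measure holds without error for every \<open>n\<close>, and invariance up to \<open>O(1/n)\<close>.
\<close>

definition cesaro_exp ::
    "((int \<Rightarrow> 'a::finite) \<Rightarrow> real) \<Rightarrow> (int \<Rightarrow> 'a) \<Rightarrow> nat \<Rightarrow> ((int \<Rightarrow> 'a) \<Rightarrow> real) \<Rightarrow> real" where
  "cesaro_exp g z n h = (\<Sum>j<n. stopped_exp g z n (\<lambda>x. h ((shift ^^ j) x))) / real n"

lemma cesaro_exp_add:
  "cesaro_exp g z n (\<lambda>x. f x + h x) = cesaro_exp g z n f + cesaro_exp g z n h"
  by (simp add: cesaro_exp_def stopped_exp_add sum.distrib add_divide_distrib)

lemma cesaro_exp_scale: "cesaro_exp g z n (\<lambda>x. c * f x) = c * cesaro_exp g z n f"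
  by (simp add: cesaro_exp_def stopped_exp_scale sum_distrib_left[symmetric])

lemma cesaro_exp_mono:
  "g_function g \<Longrightarrow> (\<And>x. f x \<le> h x) \<Longrightarrow> cesaro_exp g z n f \<le> cesaro_exp g z n h"
  unfolding cesaro_exp_def by (intro divide_right_mono sum_mono stopped_exp_mono) auto

lemma cesaro_exp_const: "g_function g \<Longrightarrow> cesaro_exp g z (Suc n) (\<lambda>x. c) = c"
  by (simp add: cesaro_exp_def stopped_exp_const del: stopped_exp.simps)

text \<open>The shift moves the window of averaging by one, so all but the two extreme terms cancel.\<close>

lemma cesaro_exp_shift:
  assumes g: "g_function g" and B: "\<And>x. \<bar>h x\<bar> \<le> B"
  shows "\<bar>cesaro_exp g z n (\<lambda>x. h (shift x)) - cesaro_exp g z n h\<bar> \<le> 2 * B / real n"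
proof -
  define u where "u j = stopped_exp g z n (\<lambda>x. h ((shift ^^ j) x))" for j
  have "cesaro_exp g z n (\<lambda>x. h (shift x)) - cesaro_exp g z n h = (\<Sum>j<n. u (Suc j) - u j) / real n"
    by (simp add: cesaro_exp_def u_def sum_subtractf diff_divide_distrib)
  also have "\<dots> = (u n - u 0) / real n"
    by (simp only: sum_lessThan_telescope)
  finally have eq: "cesaro_exp g z n (\<lambda>x. h (shift x)) - cesaro_exp g z n h = (u n - u 0) / real n" .
  have "\<bar>u j\<bar> \<le> B" for j
  proof -
    have "stopped_exp g z n (\<lambda>x. - B) \<le> u j" "u j \<le> stopped_exp g z n (\<lambda>x. B)"
      unfolding u_def using B by (auto intro!: stopped_exp_mono[OF g] simp: abs_le_iff minus_le_iff)
    then show ?thesis by (simp add: stopped_exp_const[OF g] abs_le_iff)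
  qed
  from this[of n] this[of 0] have "\<bar>u n - u 0\<bar> \<le> 2 * B" by linarith
  then show ?thesis by (simp add: eq abs_divide divide_right_mono)
qed

lemma cesaro_exp_step:
  assumes "g_function g"
  shows "cesaro_exp g z n (\<lambda>x. indicator {y. y 0 = a} x * f (past_of x))
    = cesaro_exp g z n (\<lambda>x. g_weight g a x * f (past_of x))"
  unfolding cesaro_exp_def using stopped_exp_step[OF assms] by simp

text \<open>
  A finitely additive invariant \<open>g\<close>-measure: the last assumption is compatibility in integrated form,
  tested on all bounded functions of the past.
\<close>

locale g_mean = mean \<Lambda> for \<Lambda> :: "((int \<Rightarrow> 'a::finite) \<Rightarrow> real) \<Rightarrow> real" +
  fixes g :: "(int \<Rightarrow> 'a) \<Rightarrow> real"
  assumes g: "g_function g"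
    and mean_shift: "bounded (range h) \<Longrightarrow> \<Lambda> (\<lambda>x. h (shift x)) = \<Lambda> h"
    and mean_step: "bounded (range f) \<Longrightarrow>
      \<Lambda> (\<lambda>x. indicator {y. y 0 = a} x * f (past_of x)) = \<Lambda> (\<lambda>x. g_weight g a x * f (past_of x))"

text \<open>
  The limit of the averages along the filter exists for all bounded functions at once and inherits
  the exact equation \<open>cesaro_exp_step\<close>; the error in \<open>cesaro_exp_shift\<close> disappears in the limit.
\<close>

lemma g_mean_exists:
  assumes g: "g_function g"
  obtains \<Lambda> where "g_mean \<Lambda> g"
proof -
  obtain G where G: "G \<le> sequentially" "G \<noteq> bot"
    and conv: "\<And>u :: nat \<Rightarrow> real. bounded (range u) \<Longrightarrow> \<exists>l. (u \<longlongrightarrow> l) G"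
    using bounded_sequences_converge_along_filter by blast
  fix z :: "int \<Rightarrow> 'a"
  (* The average for n = 0 is 0 / 0 = 0, so the index starts at 1. *)
  define a where "a n = cesaro_exp g z (Suc n)" for n
  define \<Lambda> where "\<Lambda> h = Lim G (\<lambda>n. a n h)" for h
  have lim: "((\<lambda>n. a n h) \<longlongrightarrow> \<Lambda> h) G" if h: "bounded (range h)" for h
  proof -
    obtain B where B: "\<And>x. \<bar>h x\<bar> \<le> B"
      using h by (auto simp: bounded_real)
    have "- B \<le> a n h \<and> a n h \<le> B" for n
      using cesaro_exp_mono[OF g, of "\<lambda>_. - B" h z "Suc n"] cesaro_exp_mono[OF g, of h "\<lambda>_. B" z "Suc n"] B
      by (simp add: cesaro_exp_const[OF g] a_def abs_le_iff minus_le_iff)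
    then have "bounded (range (\<lambda>n. a n h))"
      by (intro boundedI[of _ B]) (auto simp: abs_le_iff minus_le_iff)
    then obtain l where "((\<lambda>n. a n h) \<longlongrightarrow> l) G"
      using conv by blast
    then show ?thesis
      unfolding \<Lambda>_def using G(2) tendsto_Lim by blast
  qed
  have "mean \<Lambda>"
  proof
    fix f h :: "(int \<Rightarrow> 'a) \<Rightarrow> real" and c :: real
    show "\<Lambda> (\<lambda>x. f x + h x) = \<Lambda> f + \<Lambda> h" if "bounded (range f)" "bounded (range h)"
    proof (rule tendsto_unique[OF G(2) lim[OF bounded_range_add[OF that]]])
      show "((\<lambda>n. a n (\<lambda>x. f x + h x)) \<longlongrightarrow> \<Lambda> f + \<Lambda> h) G"
        unfolding a_def cesaro_exp_add using tendsto_add[OF that[THEN lim]] by (simp add: a_def)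
    qed
    show "\<Lambda> (\<lambda>x. c * f x) = c * \<Lambda> f" if "bounded (range f)"
    proof (rule tendsto_unique[OF G(2) lim])
      show "bounded (range (\<lambda>x. c * f x))"
        using bounded_range_mult[of "\<lambda>_. c" f] that by simp
      show "((\<lambda>n. a n (\<lambda>x. c * f x)) \<longlongrightarrow> c * \<Lambda> f) G"
        unfolding a_def cesaro_exp_scale using tendsto_mult_left[OF lim[OF that]] by (simp add: a_def)
    qed
    show "\<Lambda> f \<le> \<Lambda> h" if "bounded (range f)" "bounded (range h)" "\<And>x. f x \<le> h x"
      by (rule tendsto_le[OF G(2) that(2,1)[THEN lim]])
        (simp add: a_def cesaro_exp_mono[OF g] that(3))
    show "\<Lambda> (\<lambda>x. 1) = 1"
      by (simp add: \<Lambda>_def a_def cesaro_exp_const[OF g] tendsto_Lim[OF G(2) tendsto_const])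
  qed
  moreover have "\<Lambda> (\<lambda>x. h (shift x)) = \<Lambda> h" if h: "bounded (range h)" for h
  proof -
    obtain B where B: "\<And>x. \<bar>h x\<bar> \<le> B"
      using h by (auto simp: bounded_real)
    have sh: "bounded (range (\<lambda>x. h (shift x)))"
      by (rule bounded_subset[OF h]) auto
    have "((\<lambda>n. 2 * B / real (Suc n)) \<longlongrightarrow> 0) sequentially"
      using filterlim_compose[OF lim_const_over_n[of "2 * B"] filterlim_Suc] by simp
    then have "((\<lambda>n. 2 * B / real (Suc n)) \<longlongrightarrow> 0) G"
      using G(1) tendsto_mono by blast
    moreover have "\<forall>n. norm (a n (\<lambda>x. h (shift x)) - a n h) \<le> 2 * B / real (Suc n)"
      unfolding a_def real_norm_def by (intro allI cesaro_exp_shift[OF g] B)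
    ultimately have "((\<lambda>n. a n (\<lambda>x. h (shift x)) - a n h) \<longlongrightarrow> 0) G"
      by (rule Lim_null_comparison[OF always_eventually, rotated])
    moreover have "((\<lambda>n. a n (\<lambda>x. h (shift x)) - a n h) \<longlongrightarrow> \<Lambda> (\<lambda>x. h (shift x)) - \<Lambda> h) G"
      by (intro tendsto_diff lim h sh)
    ultimately have "\<Lambda> (\<lambda>x. h (shift x)) - \<Lambda> h = 0"
      by (rule tendsto_unique[OF G(2), rotated])
    then show ?thesis by simp
  qed
  moreover have "\<Lambda> (\<lambda>x. indicator {y. y 0 = b} x * f (past_of x)) = \<Lambda> (\<lambda>x. g_weight g b x * f (past_of x))"
    for f b
    by (simp add: \<Lambda>_def a_def cesaro_exp_step[OF g])
  ultimately show ?thesis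
    using g by (intro that[of \<Lambda>]) (simp add: g_mean_def g_mean_axioms_def)
qed

section \<open>Cylinder sets\<close>

text \<open>
  The sequences that agree with \<open>x\<close> on \<open>{-k..k}\<close>. These sets form a base of neighbourhoods of \<open>x\<close>,
  and for fixed \<open>k\<close> they partition the space.
\<close>

definition window :: "nat \<Rightarrow> (int \<Rightarrow> 'a) \<Rightarrow> (int \<Rightarrow> 'a) set" where
  "window k x = {y. \<forall>i. \<bar>i\<bar> \<le> int k \<longrightarrow> y i = x i}"

text \<open>
  The sets that are decided by the coordinates in some \<open>{-k..k}\<close>. Being a union of blocks of a
  partition, such a set has a complement of the same kind, so it is open and closed.
\<close>

definition cylinders :: "(int \<Rightarrow> 'a) set set" where
  "cylinders = {C. \<exists>k. \<forall>x\<in>C. window k x \<subseteq> C}"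

lemma self_in_window [simp]: "x \<in> window k x"
  by (simp add: window_def)

lemma window_eq: "y \<in> window k x \<Longrightarrow> window k y = window k x"
  by (auto simp: window_def)

lemma window_antimono: "k \<le> l \<Longrightarrow> window l x \<subseteq> window k x"
  by (force simp: window_def)

lemma cylindersI: "(\<And>x y. x \<in> C \<Longrightarrow> y \<in> window k x \<Longrightarrow> y \<in> C) \<Longrightarrow> C \<in> cylinders"
  unfolding cylinders_def by blast

lemma cylinders_Compl:
  assumes "C \<in> cylinders"
  shows "- C \<in> cylinders"
proof -
  obtain k where k: "\<forall>x\<in>C. window k x \<subseteq> C"
    using assms by (auto simp: cylinders_def)
  show ?thesis
  proof (rule cylindersI)
    fix x y assume "x \<in> - C" "y \<in> window k x"
    then show "y \<in> - C"
      using k window_eq[of y k x] self_in_window[of x k] by blast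
  qed
qed

lemma cylinders_Int:
  assumes "C \<in> cylinders" "D \<in> cylinders"
  shows "C \<inter> D \<in> cylinders"
proof -
  obtain k l where k: "\<forall>x\<in>C. window k x \<subseteq> C" and l: "\<forall>x\<in>D. window l x \<subseteq> D"
    using assms by (auto simp: cylinders_def)
  show ?thesis
    by (rule cylindersI[of _ "max k l"])
      (use k l window_antimono[of k "max k l"] window_antimono[of l "max k l"] in \<open>simp, blast\<close>)
qed

lemma cylinders_Un: "C \<in> cylinders \<Longrightarrow> D \<in> cylinders \<Longrightarrow> C \<union> D \<in> cylinders"
  using cylinders_Compl[OF cylinders_Int[OF cylinders_Compl cylinders_Compl], of C D] by simp

lemma UNIV_in_cylinders: "UNIV \<in> cylinders"
  by (rule cylindersI) simp

lemma empty_in_cylinders: "{} \<in> cylinders"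
  by (rule cylindersI) simp

lemma Int_stable_cylinders: "Int_stable cylinders"
  by (simp add: Int_stable_def cylinders_Int)

lemma ring_of_sets_cylinders: "ring_of_sets UNIV cylinders"
  by (auto simp: ring_of_sets_iff Diff_eq empty_in_cylinders cylinders_Un cylinders_Int cylinders_Compl)

lemma coordinate_in_cylinders: "{x. x i \<in> B} \<in> cylinders"
  by (rule cylindersI[of _ "nat \<bar>i\<bar>"]) (simp add: window_def)

lemma openin_seq_topology_UNIV_iff:
  "openin (seq_topology UNIV) U \<longleftrightarrow> (\<forall>x\<in>U. \<exists>k. window k x \<subseteq> U)"
proof -
  have "(\<exists>V. finite {i \<in> UNIV. V i \<noteq> UNIV} \<and> (\<forall>i\<in>UNIV. openin (discrete_topology UNIV) (V i)) \<and>
      x \<in> Pi\<^sub>E UNIV V \<and> Pi\<^sub>E UNIV V \<subseteq> U) \<longleftrightarrow> (\<exists>k. window k x \<subseteq> U)" for x :: "int \<Rightarrow> 'a"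
  proof
    assume "\<exists>V. finite {i \<in> UNIV. V i \<noteq> UNIV} \<and> (\<forall>i\<in>UNIV. openin (discrete_topology UNIV) (V i)) \<and>
      x \<in> Pi\<^sub>E UNIV V \<and> Pi\<^sub>E UNIV V \<subseteq> U"
    then obtain V where V: "finite {i. V i \<noteq> UNIV}" "\<And>i. x i \<in> V i" "Pi\<^sub>E UNIV V \<subseteq> U"
      by auto
    obtain k where k: "\<And>i. V i \<noteq> UNIV \<Longrightarrow> nat \<bar>i\<bar> \<le> k"
      using V(1) finite_nat_set_iff_bounded_le[of "(\<lambda>i. nat \<bar>i\<bar>) ` {i. V i \<noteq> UNIV}"] by auto
    have "window k x \<subseteq> Pi\<^sub>E UNIV V"
    proof
      fix y assume y: "y \<in> window k x"
      have "y i \<in> V i" for i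
      proof (cases "V i = UNIV")
        case False
        then have "\<bar>i\<bar> \<le> int k" using k[of i] by linarith
        then have "y i = x i" using y by (simp add: window_def)
        then show ?thesis using V(2) by simp
      qed simp
      then show "y \<in> Pi\<^sub>E UNIV V" by (simp add: PiE_UNIV_domain)
    qed
    then show "\<exists>k. window k x \<subseteq> U" using V(3) by blast
  next
    assume "\<exists>k. window k x \<subseteq> U"
    then obtain k where k: "window k x \<subseteq> U" by blast
    define V where "V i = (if \<bar>i\<bar> \<le> int k then {x i} else UNIV)" for i
    have "finite {i \<in> UNIV. V i \<noteq> UNIV}"
      by (rule finite_subset[of _ "{- int k..int k}"]) (auto simp: V_def split: if_splits)
    moreover have "x \<in> Pi\<^sub>E UNIV V"
      by (simp add: PiE_UNIV_domain V_def)
    moreover have "y \<in> window k x" if y: "y \<in> Pi\<^sub>E UNIV V" for y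
    proof -
      have "y i \<in> V i" for i using y by (simp add: PiE_UNIV_domain Pi_iff)
      then have "y i = x i" if "\<bar>i\<bar> \<le> int k" for i using that unfolding V_def by (metis singletonD)
      then show ?thesis by (simp add: window_def)
    qed
    ultimately show "\<exists>V. finite {i \<in> UNIV. V i \<noteq> UNIV} \<and> (\<forall>i\<in>UNIV. openin (discrete_topology UNIV) (V i)) \<and>
      x \<in> Pi\<^sub>E UNIV V \<and> Pi\<^sub>E UNIV V \<subseteq> U"
      using k by (intro exI[of _ V] conjI) (auto simp del: PiE_iff)
  qed
  then show ?thesis
    unfolding seq_topology_def openin_product_topology_alt topspace_discrete_topology by simp
qed

lemma openin_cylinder: "C \<in> cylinders \<Longrightarrow> openin (seq_topology UNIV) C"
  unfolding openin_seq_topology_UNIV_iff cylinders_def by blast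

lemma closedin_cylinder: "C \<in> cylinders \<Longrightarrow> closedin (seq_topology UNIV) C"
  using openin_cylinder[OF cylinders_Compl, of C]
  by (simp add: closedin_def PiE_UNIV_domain Compl_eq_Diff_UNIV)

lemma compact_space_seq_topology: "compact_space (seq_topology I :: (int \<Rightarrow> 'a::finite) topology)"
  unfolding seq_topology_def compact_space_product_topology
  by (simp add: compact_space_discrete_topology)

text \<open>
  An open set \<open>U\<close> is the union over \<open>k\<close> of the sets of all \<open>x\<close> whose \<open>k\<close>-th window lies in \<open>U\<close>, and
  these are cylinders.
\<close>

lemma sets_seq_borel_eq:
  "sets (seq_borel :: (int \<Rightarrow> 'a::finite) measure) = sigma_sets UNIV cylinders"
proof -
  have "sets (seq_borel :: (int \<Rightarrow> 'a) measure) = sigma_sets UNIV {U. openin (seq_topology UNIV) U}"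
    by (simp add: seq_borel_def sets_measure_of_conv)
  also have "\<dots> = sigma_sets UNIV cylinders"
  proof (rule sigma_sets_eqI)
    fix U :: "(int \<Rightarrow> 'a) set" assume "U \<in> {U. openin (seq_topology UNIV) U}"
    then have U: "\<forall>x\<in>U. \<exists>k. window k x \<subseteq> U"
      by (simp add: openin_seq_topology_UNIV_iff)
    have eq: "U = (\<Union>k. {x. window k x \<subseteq> U})"
    proof
      show "U \<subseteq> (\<Union>k. {x. window k x \<subseteq> U})" using U by blast
      show "(\<Union>k. {x. window k x \<subseteq> U}) \<subseteq> U" using self_in_window by blast
    qed
    have "{x. window k x \<subseteq> U} \<in> cylinders" for k
      by (rule cylindersI[of _ k]) (simp add: window_eq)
    then have "(\<Union>k. {x. window k x \<subseteq> U}) \<in> sigma_sets UNIV cylinders"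
      by (intro sigma_sets.Union sigma_sets.Basic)
    then show "U \<in> sigma_sets UNIV cylinders"
      by (simp only: eq[symmetric])
  next
    fix C :: "(int \<Rightarrow> 'a) set" assume "C \<in> cylinders"
    then show "C \<in> sigma_sets UNIV {U. openin (seq_topology UNIV) U}"
      using openin_cylinder by blast
  qed
  finally show ?thesis .
qed

section \<open>The measure represented by a mean\<close>

text \<open>\<open>\<Lambda>\<close> and \<open>\<mu>\<close> may differ on sets that are not cylinders.\<close>

locale mean_measure = mean \<Lambda> + prob_space \<mu>
  for \<Lambda> :: "((int \<Rightarrow> 'a::finite) \<Rightarrow> real) \<Rightarrow> real" and \<mu> :: "(int \<Rightarrow> 'a) measure" +
  assumes sets_eq: "sets \<mu> = sets seq_borel"
    and measure_cylinder: "C \<in> cylinders \<Longrightarrow> measure \<mu> C = \<Lambda> (indicator C)"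

text \<open>
  Caratheodory's extension theorem asks for continuity at the empty set. It is trivial on cylinders:
  by compactness, a decreasing sequence of nonempty closed sets has a nonempty intersection, so a
  decreasing sequence of cylinders with empty intersection is eventually empty.
\<close>

lemma mean_represented_by_measure:
  fixes \<Lambda> :: "((int \<Rightarrow> 'a::finite) \<Rightarrow> real) \<Rightarrow> real"
  assumes "mean \<Lambda>"
  obtains \<mu> where "mean_measure \<Lambda> \<mu>"
proof -
  interpret mean \<Lambda> by fact
  interpret C: ring_of_sets UNIV "cylinders :: (int \<Rightarrow> 'a) set set"
    by (rule ring_of_sets_cylinders)
  let ?f = "\<lambda>C :: (int \<Rightarrow> 'a) set. ennreal (\<Lambda> (indicator C))"
  have nonneg_ind: "0 \<le> \<Lambda> (indicator C)" for C
    by (rule nonneg) (auto intro: bounded_range_indicator)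
  have ind_empty: "\<Lambda> (indicator {}) = 0"
    using zero by (simp add: indicator_def[abs_def])
  have "positive cylinders ?f"
    by (simp add: positive_def ind_empty)
  moreover have "additive cylinders ?f"
    unfolding additive_def
  proof (intro ballI impI)
    fix C D :: "(int \<Rightarrow> 'a) set" assume "C \<inter> D = {}"
    then have "indicator (C \<union> D) = (\<lambda>x. indicator C x + indicator D x :: real)"
      by (auto simp: indicator_def fun_eq_iff)
    then show "?f (C \<union> D) = ?f C + ?f D"
      using add[OF bounded_range_indicator bounded_range_indicator, of C D]
      by (simp add: nonneg_ind flip: ennreal_plus)
  qed
  moreover have "(\<lambda>i. ?f (A i)) \<longlonglongrightarrow> 0"
    if A: "range A \<subseteq> cylinders" "decseq A" "(\<Inter>i. A i) = {}" for A
  proof -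
    obtain n where n: "A n = {}"
      using compact_space_imp_nest[OF compact_space_seq_topology, of UNIV A] A closedin_cylinder
      by blast
    have "A i = {}" if "n \<le> i" for i
      using decseqD[OF A(2) that] n by simp
    then have "eventually (\<lambda>i. 0 = ?f (A i)) sequentially"
      by (intro eventually_sequentiallyI[of n]) (simp add: ind_empty)
    then show ?thesis
      by (rule Lim_transform_eventually[OF tendsto_const])
  qed
  ultimately obtain m :: "(int \<Rightarrow> 'a) set \<Rightarrow> ennreal"
    where m: "\<forall>C\<in>cylinders. m C = ?f C" "measure_space UNIV (sigma_sets UNIV cylinders) m"
    using C.caratheodory_empty_continuous[of ?f] by auto
  define \<mu> where "\<mu> = measure_of UNIV cylinders m"
  have sets: "sets \<mu> = sigma_sets UNIV cylinders"
    by (simp add: \<mu>_def sets_measure_of_conv)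
  have m_eq: "emeasure \<mu> C = m C" if "C \<in> sigma_sets UNIV cylinders" for C
    using m(2) that unfolding \<mu>_def measure_space_def
    by (intro emeasure_measure_of[OF refl]) (auto simp: sets_measure_of_conv)
  have cyl: "emeasure \<mu> C = ?f C" if "C \<in> cylinders" for C
    using m(1) m_eq[of C] that by (simp add: sigma_sets.Basic)
  have "mean_measure \<Lambda> \<mu>"
  proof (intro mean_measure.intro mean_measure_axioms.intro)
    show "prob_space \<mu>"
    proof
      have "space \<mu> = UNIV" by (simp add: \<mu>_def space_measure_of_conv)
      then show "emeasure \<mu> (space \<mu>) = 1"
        using cyl[OF UNIV_in_cylinders] one by (simp add: indicator_def[abs_def])
    qed
    show "sets \<mu> = sets seq_borel"
      by (simp add: sets sets_seq_borel_eq)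
    show "measure \<mu> C = \<Lambda> (indicator C)" if "C \<in> cylinders" for C
      using cyl[OF that] nonneg_ind by (simp add: measure_def)
  qed fact
  then show ?thesis by (rule that)
qed

definition window_continuous :: "((int \<Rightarrow> 'a) \<Rightarrow> real) \<Rightarrow> (int \<Rightarrow> 'a) \<Rightarrow> bool" where
  "window_continuous h x \<longleftrightarrow> (\<forall>\<delta>>0. \<exists>k. \<forall>y\<in>window k x. \<bar>h y - h x\<bar> < \<delta>)"

context mean_measure
begin

lemma space_eq [simp]: "space \<mu> = UNIV"
  using sets_eq_imp_space_eq[OF sets_eq] by simp

lemma cylinder_in_sets: "C \<in> cylinders \<Longrightarrow> C \<in> sets \<mu>"
  unfolding sets_eq sets_seq_borel_eq by (rule sigma_sets.Basic)

text \<open>Such a function has finitely many values, each of them on a cylinder.\<close>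

lemma integral_eq_mean_window:
  assumes h: "\<And>x y. y \<in> window k x \<Longrightarrow> h y = h x"
  shows "integrable \<mu> h \<and> integral\<^sup>L \<mu> h = \<Lambda> h"
proof -
  let ?I = "{- int k..int k}"
  have "h x = h (restrict x ?I)" for x
    by (rule h[symmetric]) (auto simp: window_def restrict_def abs_le_iff)
  then have "h x \<in> h ` (?I \<rightarrow>\<^sub>E UNIV)" for x
    using imageI[of "restrict x ?I" "?I \<rightarrow>\<^sub>E UNIV" h] by (metis restrict_PiE_iff UNIV_I)
  then have "range h \<subseteq> h ` (?I \<rightarrow>\<^sub>E UNIV)"
    by blast
  then have fin: "finite (range h)"
    by (rule finite_subset) (simp add: finite_PiE)
  have cyl: "{x. h x = v} \<in> cylinders" for v
    by (rule cylindersI[of _ k]) (simp add: h)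
  have sum: "h = (\<lambda>x. \<Sum>v\<in>range h. v * indicator {x. h x = v} x)"
  proof
    fix x
    have "(\<Sum>v\<in>range h. v * indicator {x. h x = v} x) = (\<Sum>v\<in>range h. if v = h x then v else 0)"
      by (intro sum.cong) (auto simp: indicator_def)
    also have "\<dots> = h x"
      using fin by (simp add: sum.delta')
    finally show "h x = (\<Sum>v\<in>range h. v * indicator {x. h x = v} x)" by simp
  qed
  have int: "integrable \<mu> (\<lambda>x. v * indicator {x. h x = v} x)" for v
    using cylinder_in_sets[OF cyl] by (intro integrable_mult_right integrable_real_indicator) (auto simp: less_top[symmetric])
  have bdd: "bounded (range (\<lambda>x. v * indicator {x. h x = v} x))" for v
    by (intro boundedI[of _ "\<bar>v\<bar>"]) (auto simp: indicator_def)
  have "\<Lambda> (\<lambda>x. \<Sum>v\<in>range h. v * indicator {x. h x = v} x) =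
      (\<Sum>v\<in>range h. \<Lambda> (\<lambda>x. v * indicator {x. h x = v} x))"
    by (rule conjunct1[OF finite_sum[OF fin bdd]])
  also have "\<dots> = (\<Sum>v\<in>range h. v * measure \<mu> {x. h x = v})"
    by (simp add: scale bounded_range_indicator measure_cylinder cyl)
  also have "\<dots> = integral\<^sup>L \<mu> (\<lambda>x. \<Sum>v\<in>range h. v * indicator {x. h x = v} x)"
    using int cylinder_in_sets[OF cyl] by (simp add: Bochner_Integration.integral_sum)
  finally have "\<Lambda> h = integral\<^sup>L \<mu> h"
    unfolding sum[symmetric] .
  moreover have "integrable \<mu> (\<lambda>x. \<Sum>v\<in>range h. v * indicator {x. h x = v} x)"
    using int by (intro Bochner_Integration.integrable_sum)
  ultimately show ?thesis
    unfolding sum[symmetric] by simp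
qed

text \<open>
  The supremum of \<open>h\<close> over the \<open>k\<close>-th window is a function of finitely many coordinates, so mean and
  integral agree on it. It dominates \<open>h\<close>, and it converges to \<open>h\<close> at the points of continuity; hence
  dominated convergence gives the bound.
\<close>

lemma mean_le_integral:
  assumes h: "bounded (range h)" "h \<in> borel_measurable \<mu>" and cont: "AE x in \<mu>. window_continuous h x"
  shows "\<Lambda> h \<le> integral\<^sup>L \<mu> h"
proof -
  obtain B where B: "\<And>x. \<bar>h x\<bar> \<le> B"
    using h(1) by (auto simp: bounded_real)
  define s where "s k x = (SUP y\<in>window k x. h y)" for k x
  have bdd: "bdd_above (h ` window k x)" for k x
    using B by (intro bdd_aboveI2[of _ _ B]) (simp add: abs_le_iff)
  have ne: "window k x \<noteq> {}" for k and x :: "int \<Rightarrow> 'a"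
    using self_in_window by blast
  have s_ge: "h x \<le> s k x" for k x
    unfolding s_def by (rule cSUP_upper[OF self_in_window bdd])
  have s_le: "s k x \<le> c" if "\<And>y. y \<in> window k x \<Longrightarrow> h y \<le> c" for k x c
    unfolding s_def by (rule cSUP_least[OF ne that])
  have s_B: "\<bar>s k x\<bar> \<le> B" for k x
    using s_le[of k x B] s_ge[of x k] B[of x] B by (simp add: abs_le_iff) (smt (verit))
  have s_loc: "s k y = s k x" if "y \<in> window k x" for k x y
    using window_eq[OF that] by (simp add: s_def)
  note s_int = integral_eq_mean_window[of k "s k" for k, OF s_loc]
  have "\<Lambda> h \<le> integral\<^sup>L \<mu> (s k)" for k
  proof -
    have "bounded (range (s k))"
      using s_B by (intro boundedI[of _ B]) auto
    then have "\<Lambda> h \<le> \<Lambda> (s k)"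
      using h(1) s_ge by (intro mono)
    then show ?thesis using s_int by simp
  qed
  moreover have "(\<lambda>k. integral\<^sup>L \<mu> (s k)) \<longlonglongrightarrow> integral\<^sup>L \<mu> h"
  proof (rule integral_dominated_convergence[where w = "\<lambda>_. B"])
    show "AE x in \<mu>. (\<lambda>k. s k x) \<longlonglongrightarrow> h x"
      using cont
    proof (rule AE_mp, intro AE_I2 impI)
      fix x assume x: "window_continuous h x"
      show "(\<lambda>k. s k x) \<longlonglongrightarrow> h x"
      proof (rule LIMSEQ_I)
        fix r :: real assume "0 < r"
        then obtain k where k: "\<And>y. y \<in> window k x \<Longrightarrow> \<bar>h y - h x\<bar> < r / 2"
          using x unfolding window_continuous_def by (metis half_gt_zero)
        have "norm (s l x - h x) < r" if "k \<le> l" for l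
        proof -
          have "s l x \<le> h x + r / 2"
          proof (rule s_le)
            fix y assume "y \<in> window l x"
            then have "y \<in> window k x" using window_antimono[OF that] by blast
            from k[OF this] show "h y \<le> h x + r / 2" by linarith
          qed
          then show ?thesis using s_ge[of x l] \<open>0 < r\<close> by simp
        qed
        then show "\<exists>k. \<forall>l\<ge>k. norm (s l x - h x) < r" by blast
      qed
    qed
    show "s k \<in> borel_measurable \<mu>" for k
      using s_int by blast
    show "AE x in \<mu>. norm (s k x) \<le> B" for k
      using s_B by simp
  qed (use h(2) in auto)
  ultimately show ?thesis
    using LIMSEQ_le_const by blast
qed

lemma mean_eq_integral:
  assumes h: "bounded (range h)" "h \<in> borel_measurable \<mu>" and cont: "AE x in \<mu>. window_continuous h x"
  shows "\<Lambda> h = integral\<^sup>L \<mu> h"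
proof (rule antisym)
  show "\<Lambda> h \<le> integral\<^sup>L \<mu> h"
    by (rule mean_le_integral) fact+
  have "\<Lambda> (\<lambda>x. - h x) \<le> integral\<^sup>L \<mu> (\<lambda>x. - h x)"
  proof (rule mean_le_integral)
    show "bounded (range (\<lambda>x. - h x))"
      using bounded_range_mult[of "\<lambda>_. -1" h] h(1) by (simp add: image_constant_conv)
    show "AE x in \<mu>. window_continuous (\<lambda>x. - h x) x"
      using cont by (rule AE_mp) (simp add: window_continuous_def abs_minus_commute)
  qed (use h(2) in simp)
  then show "integral\<^sup>L \<mu> h \<le> \<Lambda> h"
    by (simp add: uminus[OF h(1)])
qed

end

section \<open>The represented measure is an invariant g-measure\<close>

lemma coordinate_measurable_coord_algebra:
  assumes "i \<le> n"
  shows "(\<lambda>x. x i) \<in> measurable (coord_algebra n) (count_space UNIV)"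
proof (rule measurableI)
  fix B :: "'a set"
  have "{x. x i \<in> B} \<in> sets (coord_algebra n)"
    unfolding coord_algebra_def sets_measure_of_conv using assms by auto
  then show "(\<lambda>x. x i) -` B \<inter> space (coord_algebra n) \<in> sets (coord_algebra n)"
    by (simp add: coord_algebra_def space_measure_of_conv vimage_def)
qed simp

lemma g_weight_measurable:
  assumes "g_function g"
  shows "g_weight g a \<in> borel_measurable (coord_algebra (-1))"
proof -
  have "(\<lambda>x i. append0 (past_of x) a i) \<in> measurable (coord_algebra (-1)) (PiM {..0} (\<lambda>_. count_space UNIV))"
  proof (rule measurable_PiM_single')
    fix i :: int assume "i \<in> {..0}"
    then consider "i = 0" | "i \<le> -1" by fastforce
    then show "(\<lambda>x. append0 (past_of x) a i) \<in> measurable (coord_algebra (-1)) (count_space UNIV)"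
    proof cases
      case 1
      then show ?thesis by (simp add: append0_def)
    next
      case 2
      then have "append0 (past_of x) a i = x i" for x
        by (simp add: append0_def past_of_def)
      then show ?thesis
        using coordinate_measurable_coord_algebra[OF 2] by simp
    qed
  next
    show "(\<lambda>x i. append0 (past_of x) a i) \<in> space (coord_algebra (-1)) \<rightarrow> (\<Pi>\<^sub>E i\<in>{..0}. space (count_space UNIV))"
      using append0_past_of_in_pasts0 unfolding pasts0_def by (intro funcsetI) simp
  qed
  moreover have "g \<in> borel_measurable (PiM {..0} (\<lambda>_. count_space UNIV))"
    using assms by (simp add: g_function_def)
  ultimately show ?thesis
    unfolding g_weight_def[abs_def] by (rule measurable_compose)
qed

text \<open>
  The index range \<open>{-k..<0}\<close> has exactly \<open>k\<close> elements, which gives the exponent in the decay of the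
  probability of these sets.
\<close>

definition same_past :: "nat \<Rightarrow> (int \<Rightarrow> 'a) \<Rightarrow> (int \<Rightarrow> 'a) set" where
  "same_past k d = {x. \<forall>i\<in>{- int k..<0}. x i = d i}"

text \<open>
  Shifting brings the last of the \<open>k + 1\<close> prescribed letters to \<open>0\<close>, where its conditional
  probability is known, and leaves \<open>k\<close> letters prescribed before it.
\<close>

lemma same_past_Suc_shift:
  "shift x \<in> same_past (Suc k) d \<longleftrightarrow> x 0 = d (-1) \<and> past_of x \<in> same_past k (\<lambda>i. d (i - 1))"
    (is "?l \<longleftrightarrow> ?r")
proof
  assume ?l
  then have l: "x (i + 1) = d i" if "- int (Suc k) \<le> i" "i < 0" for i
    using that by (simp add: same_past_def shift_def)
  show ?r
    using l[of "-1"] l[of "i - 1" for i] by (simp add: same_past_def past_of_def)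
next
  assume r: ?r
  have "x (i + 1) = d i" if "- int (Suc k) \<le> i" "i < 0" for i
  proof (cases "i = -1")
    case False
    then have "i + 1 \<in> {- int k..<0}" using that by simp
    then have "past_of x (i + 1) = d (i + 1 - 1)"
      using r unfolding same_past_def by blast
    then show ?thesis using False that by (simp add: past_of_def)
  qed (use r in simp)
  then show ?l by (simp add: same_past_def shift_def)
qed

lemma past_of_in_same_past: "past_of x \<in> same_past k d \<longleftrightarrow> x \<in> same_past k d"
  by (simp add: same_past_def past_of_def)

lemma same_past_in_cylinders: "same_past k d \<in> cylinders"
  by (rule cylindersI[of _ k]) (simp add: same_past_def window_def)

text \<open>
  By invariance and the one-step equation, prescribing one more letter costs a factor of at most
  \<open>c\<close>.
\<close>

lemma (in g_mean) mean_same_past_le: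
  assumes c: "\<And>a x. g_weight g a x \<le> c" "0 \<le> c"
  shows "\<Lambda> (indicator (same_past k d)) \<le> c ^ k"
proof (induction k arbitrary: d)
  case 0
  have "indicator (same_past 0 d) = (\<lambda>x. 1 :: real)"
    by (simp add: same_past_def indicator_def[abs_def])
  then show ?case using one by simp
next
  case (Suc k)
  define f :: "(int \<Rightarrow> 'a) \<Rightarrow> real" where "f = indicator (same_past k (\<lambda>i. d (i - 1)))"
  have f: "f (past_of x) = f x" "0 \<le> f x" for x
    by (simp_all add: f_def past_of_in_same_past indicator_def)
  have bf: "bounded (range f)"
    unfolding f_def by (rule bounded_range_indicator)
  have "\<Lambda> (indicator (same_past (Suc k) d)) = \<Lambda> (\<lambda>x. indicator (same_past (Suc k) d) (shift x))"
    by (rule mean_shift[symmetric]) (rule bounded_range_indicator)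
  also have "\<dots> = \<Lambda> (\<lambda>x. indicator {y. y 0 = d (-1)} x * f (past_of x))"
    by (rule arg_cong[where f = \<Lambda>]) (auto simp: f_def indicator_def same_past_Suc_shift fun_eq_iff)
  also have "\<dots> = \<Lambda> (\<lambda>x. g_weight g (d (-1)) x * f (past_of x))"
    by (rule mean_step[OF bf])
  also have "\<dots> \<le> \<Lambda> (\<lambda>x. c * f x)"
  proof (rule mono)
    show "bounded (range (\<lambda>x. g_weight g (d (-1)) x * f (past_of x)))"
      unfolding f(1) by (rule bounded_range_mult[OF bounded_range_g_weight[OF g] bf])
    show "bounded (range (\<lambda>x. c * f x))"
      using bounded_range_mult[of "\<lambda>_. c", OF _ bf] by (simp add: image_constant_conv)
    show "g_weight g (d (-1)) x * f (past_of x) \<le> c * f x" for x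
      unfolding f(1) by (rule mult_right_mono[OF c(1) f(2)])
  qed
  also have "\<dots> = c * \<Lambda> f"
    by (rule scale[OF bf])
  also have "\<dots> \<le> c * c ^ k"
    unfolding f_def by (rule mult_left_mono[OF Suc.IH c(2)])
  finally show ?case by simp
qed

locale g_mean_measure = g_mean \<Lambda> g + mean_measure \<Lambda> \<mu>
  for \<Lambda> :: "((int \<Rightarrow> 'a::finite) \<Rightarrow> real) \<Rightarrow> real" and g and \<mu>
begin

lemma distr_shift: "distr \<mu> \<mu> shift = \<mu>"
proof (rule measure_eqI_generator_eq[OF Int_stable_cylinders, where \<Omega> = UNIV and A = "\<lambda>_. UNIV"])
  fix C :: "(int \<Rightarrow> 'a) set" assume C: "C \<in> cylinders"
  then obtain k where k: "\<forall>x\<in>C. window k x \<subseteq> C"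
    by (auto simp: cylinders_def)
  have vC: "shift -` C \<in> cylinders"
  proof (rule cylindersI)
    fix x y assume x: "x \<in> shift -` C" and y: "y \<in> window (Suc k) x"
    have "shift y \<in> window k (shift x)"
      using y by (simp add: window_def shift_def)
    then show "y \<in> shift -` C" using k x by blast
  qed
  have "measure \<mu> (shift -` C) = \<Lambda> (\<lambda>x. indicator C (shift x))"
    unfolding measure_cylinder[OF vC]
    by (rule arg_cong[where f = \<Lambda>]) (simp add: indicator_def fun_eq_iff)
  also have "\<dots> = measure \<mu> C"
    using measure_cylinder[OF C] mean_shift[OF bounded_range_indicator] by simp
  finally show "emeasure (distr \<mu> \<mu> shift) C = emeasure \<mu> C"
    using emeasure_distr[OF measurable_shift[OF sets_eq] cylinder_in_sets[OF C]]
    by (simp add: emeasure_eq_measure)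
next
  show "emeasure (distr \<mu> \<mu> shift) UNIV \<noteq> \<infinity>" for i :: nat
    using emeasure_distr[OF measurable_shift[OF sets_eq], of UNIV] sets.top[of \<mu>]
    by (simp add: emeasure_eq_measure)
qed (simp_all add: sets_eq sets_seq_borel_eq UNIV_in_cylinders)

text \<open>
  The set of points with a given past is contained in cylinders of probability at most \<open>c ^ k\<close> for all
  \<open>k\<close>. The detour through cylinders is essential, since \<open>\<Lambda>\<close> is not known to agree with \<open>\<mu>\<close> on
  the set itself.
\<close>

lemma past_almost_surely_avoids_point:
  assumes c: "\<And>a x. g_weight g a x \<le> c" "0 \<le> c" "c < 1"
  shows "AE x in \<mu>. past_of x \<noteq> d"
proof -
  have sets: "same_past k d \<in> sets \<mu>" for k
    by (rule cylinder_in_sets[OF same_past_in_cylinders])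
  define N where "N = (\<Inter>k. same_past k d)"
  have N: "N \<in> sets \<mu>"
    unfolding N_def using sets by (intro sets.countable_INT) auto
  have "measure \<mu> N \<le> c ^ k" for k
  proof -
    have "measure \<mu> N \<le> measure \<mu> (same_past k d)"
      by (rule finite_measure_mono[OF _ sets]) (auto simp: N_def)
    also have "\<dots> \<le> c ^ k"
      using mean_same_past_le[OF c(1,2)] measure_cylinder[OF same_past_in_cylinders, of k d] by simp
    finally show ?thesis .
  qed
  moreover have "(\<lambda>k. c ^ k) \<longlonglongrightarrow> 0"
    using c(2,3) by (intro LIMSEQ_power_zero) simp
  ultimately have "measure \<mu> N \<le> 0"
    using LIMSEQ_le_const by blast
  then have "N \<in> null_sets \<mu>"
    using N by (simp add: null_sets_def emeasure_eq_measure measure_le_0_iff)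
  then have "AE x in \<mu>. x \<notin> N"
    by (rule AE_not_in)
  moreover have "past_of x \<noteq> d" if "x \<notin> N" for x
    using that past_of_in_same_past[of x] by (auto simp: N_def same_past_def)
  ultimately show ?thesis
    by (rule eventually_mono)
qed

end

text \<open>
  With a single letter there is no decay of cylinders, because a \<open>g\<close>-function is constantly \<open>1\<close>; but
  then the space of pasts is a point.
\<close>

lemma discontinuities_empty_if_one_letter:
  fixes g :: "(int \<Rightarrow> 'a::finite) \<Rightarrow> real"
  assumes "\<And>a b :: 'a. a = b"
  shows "discontinuities g = {}"
proof -
  have "x = y" if "x \<in> pasts" "y \<in> pasts" for x y :: "int \<Rightarrow> 'a"
    using that assms unfolding pasts_def by (rule PiE_ext)
  then have const: "xs = (\<lambda>_. x)" if "x \<in> pasts" "\<forall>k. xs k \<in> pasts"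
    for x and xs :: "nat \<Rightarrow> int \<Rightarrow> 'a"
    using that by blast
  have "g_continuous_at g x" if "x \<in> pasts" for x
    unfolding g_continuous_at_def
  proof (intro allI impI, elim conjE)
    fix a :: 'a and xs :: "nat \<Rightarrow> int \<Rightarrow> 'a"
    assume "\<forall>k. xs k \<in> pasts"
    from const[OF \<open>x \<in> pasts\<close> this] show "(\<lambda>k. g (append0 (xs k) a)) \<longlonglongrightarrow> g (append0 x a)"
      by simp
  qed
  then show ?thesis
    by (auto simp: discontinuities_def)
qed

text \<open>
  Sequential continuity yields the formulation with windows: otherwise a choice of a bad point in
  each window would give a sequence of pasts that converges to the past of \<open>x\<close>.
\<close>

lemma window_continuous_g_weight:
  assumes "past_of x \<notin> discontinuities g"
  shows "window_continuous (g_weight g a) x"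
proof (rule ccontr)
  assume "\<not> window_continuous (g_weight g a) x"
  then obtain \<delta> where \<delta>: "\<delta> > 0" "\<forall>k. \<exists>y\<in>window k x. \<not> \<bar>g_weight g a y - g_weight g a x\<bar> < \<delta>"
    unfolding window_continuous_def by blast
  then obtain y where y: "\<And>k. y k \<in> window k x" "\<And>k. \<not> \<bar>g_weight g a (y k) - g_weight g a x\<bar> < \<delta>"
    by metis
  have "limitin (seq_topology {..-1}) (\<lambda>k. past_of (y k)) (past_of x) sequentially"
    unfolding seq_topology_def limitin_componentwise
  proof (intro conjI ballI)
    show "past_of x \<in> extensional {..-1}"
      by (simp add: past_of_def)
    show "\<forall>\<^sub>F k in sequentially. past_of (y k) \<in> topspace (product_topology (\<lambda>_. discrete_topology UNIV) {..-1})"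
      by (simp add: past_of_def)
    fix i :: int assume i: "i \<in> {..-1}"
    have "past_of (y k) i = past_of x i" if "nat \<bar>i\<bar> \<le> k" for k
      using y(1)[of k] that i by (simp add: window_def past_of_def)
    then have "\<forall>\<^sub>F k in sequentially. past_of (y k) i = past_of x i"
      by (rule eventually_sequentiallyI)
    then show "limitin (discrete_topology UNIV) (\<lambda>k. past_of (y k) i) (past_of x i) sequentially"
      by (simp add: limitin_def) (auto elim: eventually_mono)
  qed
  moreover have "g_continuous_at g (past_of x)"
    using assms by (simp add: discontinuities_def past_of_in_pasts)
  ultimately have "(\<lambda>k. g_weight g a (y k)) \<longlonglongrightarrow> g_weight g a x"
    by (simp add: g_continuous_at_def g_weight_def past_of_in_pasts)
  then obtain k where "\<bar>g_weight g a (y k) - g_weight g a x\<bar> < \<delta>"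
    using \<delta>(1) LIMSEQ_D by (metis le_refl real_norm_def)
  then show False using y(2) by blast
qed

lemma window_continuous_mult_indicator:
  assumes h: "window_continuous h x" and C: "C \<in> cylinders"
  shows "window_continuous (\<lambda>x. h x * indicator C x) x"
  unfolding window_continuous_def
proof (intro allI impI)
  fix \<delta> :: real assume \<delta>: "\<delta> > 0"
  obtain k where k: "\<forall>y\<in>window k x. \<bar>h y - h x\<bar> < \<delta>"
    using h \<delta> by (auto simp: window_continuous_def)
  obtain l where l: "\<forall>x\<in>C. window l x \<subseteq> C"
    using C by (auto simp: cylinders_def)
  show "\<exists>m. \<forall>y\<in>window m x. \<bar>h y * indicator C y - h x * indicator C x\<bar> < \<delta>"
  proof (intro exI ballI)
    fix y assume "y \<in> window (max k l) x"
    then have yk: "y \<in> window k x" and yl: "y \<in> window l x"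
      using window_antimono[of k "max k l" x] window_antimono[of l "max k l" x] by auto
    have "y \<in> C \<longleftrightarrow> x \<in> C"
      using l yl window_eq[OF yl] self_in_window by blast
    then show "\<bar>h y * indicator C y - h x * indicator C x\<bar> < \<delta>"
      using k yk \<delta> by (simp add: indicator_def)
  qed
qed

context g_mean_measure
begin

text \<open>
  For a cylinder \<open>C\<close> that is decided by negative coordinates, the equation holds for \<open>\<Lambda>\<close>, and both of
  its sides are means of almost everywhere continuous functions, hence integrals. Dynkin's lemma
  extends it to the \<open>\<sigma>\<close>-algebra that these cylinders generate.
\<close>

lemma set_integral_g_weight:
  assumes cont: "AE x in \<mu>. past_of x \<notin> discontinuities g"
    and A: "A \<in> sets (coord_algebra (-1))"
  shows "(LINT x:A|\<mu>. indicator {y. y 0 = a} x) = (LINT x:A|\<mu>. g_weight g a x)"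
proof -
  define E where "E = {C :: (int \<Rightarrow> 'a) set. C \<in> cylinders \<and> (\<forall>x. past_of x \<in> C \<longleftrightarrow> x \<in> C)}"
  have sub: "subalgebra \<mu> (coord_algebra (-1))"
    by (rule subalgebra_coord_algebra[OF sets_eq])
  have meas: "g_weight g a \<in> borel_measurable \<mu>"
    by (rule measurable_from_subalg[OF sub g_weight_measurable[OF g]])
  have a_sets: "{y. y 0 = a} \<in> sets \<mu>"
    using cylinder_in_sets[OF coordinate_in_cylinders[of 0 "{a}"]] by simp
  have int_a: "integrable \<mu> (indicator {y. y 0 = a} :: _ \<Rightarrow> real)"
    using a_sets by (intro integrable_real_indicator) (auto simp: less_top[symmetric])
  have int_g: "integrable \<mu> (g_weight g a)"
    by (rule integrable_const_bound[of _ 1]) (use meas in \<open>auto simp: g_weight_nonneg[OF g] g_weight_le_1[OF g]\<close>)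
  have sets_E: "B \<in> sets \<mu>" if "B \<in> sigma_sets UNIV E" for B
  proof -
    have "sigma_sets (space \<mu>) E \<subseteq> sets \<mu>"
      by (rule sets.sigma_sets_subset) (use cylinder_in_sets in \<open>auto simp: E_def\<close>)
    then show ?thesis using that by auto
  qed
  have set_int: "set_integrable \<mu> B f" if "integrable \<mu> f" "B \<in> sigma_sets UNIV E" for B and f :: "_ \<Rightarrow> real"
    unfolding set_integrable_def using integrable_mult_indicator[OF sets_E[OF that(2)] that(1)] .
  have on_E: "(LINT x:C|\<mu>. indicator {y. y 0 = a} x) = (LINT x:C|\<mu>. g_weight g a x)"
    if "C \<in> E" for C
  proof -
    from that have C: "C \<in> cylinders" and past: "indicator C (past_of x) = (indicator C x :: real)" for x
      by (auto simp: E_def indicator_def)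
    have aC: "{y. y 0 = a} \<inter> C \<in> cylinders"
      using cylinders_Int[OF coordinate_in_cylinders[of 0 "{a}"] C] by simp
    have "(LINT x:C|\<mu>. indicator {y. y 0 = a} x) = measure \<mu> ({y. y 0 = a} \<inter> C)"
      by (simp add: set_lebesgue_integral_def Int_commute flip: indicator_inter_arith)
    also have "\<dots> = \<Lambda> (\<lambda>x. indicator {y. y 0 = a} x * indicator C (past_of x))"
      unfolding measure_cylinder[OF aC] past
      by (rule arg_cong[where f = \<Lambda>]) (simp add: fun_eq_iff indicator_inter_arith)
    also have "\<dots> = \<Lambda> (\<lambda>x. g_weight g a x * indicator C x)"
      using mean_step[OF bounded_range_indicator[of C], of a] by (simp only: past)
    also have "\<dots> = integral\<^sup>L \<mu> (\<lambda>x. g_weight g a x * indicator C x)"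
    proof (rule mean_eq_integral)
      show "bounded (range (\<lambda>x. g_weight g a x * indicator C x))"
        by (rule bounded_range_mult[OF bounded_range_g_weight[OF g] bounded_range_indicator])
      show "(\<lambda>x. g_weight g a x * indicator C x) \<in> borel_measurable \<mu>"
        using meas cylinder_in_sets[OF C] by measurable
      show "AE x in \<mu>. window_continuous (\<lambda>x. g_weight g a x * indicator C x) x"
        using cont
        by (rule AE_mp) (intro AE_I2 impI window_continuous_mult_indicator[OF _ C] window_continuous_g_weight)
    qed
    also have "\<dots> = (LINT x:C|\<mu>. g_weight g a x)"
      by (simp add: set_lebesgue_integral_def mult.commute)
    finally show ?thesis .
  qed
  have A_E: "A \<in> sigma_sets UNIV E"
  proof -
    have "{{x :: int \<Rightarrow> 'a. x i \<in> B} | i B. i \<le> -1} \<subseteq> E"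
      using coordinate_in_cylinders by (auto simp: E_def past_of_def)
    then have "sigma_sets UNIV {{x :: int \<Rightarrow> 'a. x i \<in> B} | i B. i \<le> -1} \<subseteq> sigma_sets UNIV E"
      by (rule sigma_sets_mono')
    then show ?thesis
      using A by (auto simp: coord_algebra_def sets_measure_of_conv)
  qed
  have subset_Pow: "E \<subseteq> Pow UNIV"
    by simp
  have "Int_stable E"
    by (auto simp: Int_stable_def E_def cylinders_Int)
  from this subset_Pow A_E show ?thesis
  proof (induction rule: sigma_sets_induct_disjoint)
    case (basic C)
    then show ?case by (rule on_E)
  next
    case empty
    show ?case by (simp add: set_lebesgue_integral_def)
  next
    case (compl B)
    have split: "(LINT x:UNIV - B|\<mu>. f x) = integral\<^sup>L \<mu> f - (LINT x:B|\<mu>. f x)"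
      if "integrable \<mu> f" for f :: "_ \<Rightarrow> real"
    proof -
      have B: "set_integrable \<mu> B f" "set_integrable \<mu> (UNIV - B) f"
        using that compl(1) by (auto intro!: set_int sigma_sets.Compl)
      have "(LINT x:B \<union> (UNIV - B)|\<mu>. f x) = (LINT x:B|\<mu>. f x) + (LINT x:UNIV - B|\<mu>. f x)"
        by (rule set_integral_Un[OF _ B]) blast
      then show ?thesis by (simp add: set_lebesgue_integral_def)
    qed
    have "integral\<^sup>L \<mu> (indicator {y. y 0 = a} :: _ \<Rightarrow> real) = integral\<^sup>L \<mu> (g_weight g a)"
      using on_E[of UNIV] by (simp add: E_def UNIV_in_cylinders set_lebesgue_integral_def)
    then show ?case
      by (simp add: split[OF int_a] split[OF int_g] compl)
  next
    case (union B)
    have "(LINT x:(\<Union>i. B i)|\<mu>. f x) = (\<Sum>i. LINT x:B i|\<mu>. f x)"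
      if "integrable \<mu> f" for f :: "_ \<Rightarrow> real"
    proof (rule lebesgue_integral_countable_add)
      show "B i \<in> sets \<mu>" for i using union(2) sets_E by blast
      show "B i \<inter> B j = {}" if "i \<noteq> j" for i j using union(1) that by (auto simp: disjoint_family_on_def)
      show "set_integrable \<mu> (\<Union>i. B i) f"
        using union(2) by (intro set_int[OF that] sigma_sets.Union) auto
    qed
    from this[OF int_a] this[OF int_g] show ?case by (simp add: union)
  qed
qed

lemma compatible_if_continuous_ae:
  assumes "AE x in \<mu>. past_of x \<notin> discontinuities g"
  shows "compatible g \<mu>"
proof -
  have sub: "subalgebra \<mu> (coord_algebra (-1))"
    by (rule subalgebra_coord_algebra[OF sets_eq])
  interpret finite_measure_subalgebra \<mu> "coord_algebra (-1)"
    by unfold_locales (rule sub)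
  show ?thesis
    unfolding compatible_def g_weight_def[symmetric]
  proof (intro allI real_cond_exp_charact)
    fix a
    show "g_weight g a \<in> borel_measurable (coord_algebra (-1))"
      by (rule g_weight_measurable[OF g])
    then have "g_weight g a \<in> borel_measurable \<mu>"
      by (rule measurable_from_subalg[OF sub])
    then show "integrable \<mu> (g_weight g a)"
      by (intro integrable_const_bound[of _ 1]) (auto simp: g_weight_nonneg[OF g] g_weight_le_1[OF g])
    show "integrable \<mu> (indicator {y. y 0 = a} :: _ \<Rightarrow> real)"
      using cylinder_in_sets[OF coordinate_in_cylinders[of 0 "{a}"]]
      by (intro integrable_real_indicator) (auto simp: less_top[symmetric])
  qed (rule set_integral_g_weight[OF assms])
qed

end

theorem corollary1:
  fixes g :: "(int \<Rightarrow> 'a::finite) \<Rightarrow> real" and \<epsilon> :: real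
  assumes "g_function g"
    and "\<epsilon> > 0"
    and "\<forall>y\<in>pasts0. g y \<ge> \<epsilon>"
    and "countable (discontinuities g)"
  shows "invariant_g_measures g \<noteq> {}"
proof -
  obtain \<Lambda> where "g_mean \<Lambda> g"
    using g_mean_exists[OF assms(1)] .
  then interpret g_mean \<Lambda> g .
  obtain \<mu> where "mean_measure \<Lambda> \<mu>"
    using mean_represented_by_measure[OF mean_axioms] .
  then interpret mean_measure \<Lambda> \<mu> .
  interpret g_mean_measure \<Lambda> g \<mu> ..
  have "AE x in \<mu>. past_of x \<notin> discontinuities g"
  proof (cases "\<exists>a b :: 'a. a \<noteq> b")
    case True
    have eps: "\<epsilon> \<le> g_weight g a x" for a x
      unfolding g_weight_def by (rule bspec[OF assms(3) append0_past_of_in_pasts0])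
    (* A second letter has weight at least \<epsilon>, which leaves at most 1 - \<epsilon> for a. *)
    have le: "g_weight g a x \<le> 1 - \<epsilon>" for a x
    proof -
      obtain b where "b \<noteq> a" using True by metis
      then have "g_weight g a x + g_weight g b x = (\<Sum>c\<in>{a, b}. g_weight g c x)"
        by simp
      also have "\<dots> \<le> (\<Sum>c\<in>UNIV. g_weight g c x)"
        by (rule sum_mono2) (auto simp: g_weight_nonneg[OF g])
      finally show ?thesis
        using sum_g_weight[OF g, of x] eps[of b x] by linarith
    qed
    have "0 \<le> 1 - \<epsilon>"
      using le eps \<open>\<epsilon> > 0\<close> by (meson less_imp_le order_trans)
    then have "AE x in \<mu>. past_of x \<noteq> d" for d
      using past_almost_surely_avoids_point[OF le] \<open>\<epsilon> > 0\<close> by simp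
    then have "AE x in \<mu>. \<forall>d\<in>discontinuities g. past_of x \<noteq> d"
      by (simp add: AE_ball_countable[OF assms(4)])
    then show ?thesis
      by (rule eventually_mono) auto
  next
    case False
    then show ?thesis
      using discontinuities_empty_if_one_letter[of g] by simp
  qed
  then have "compatible g \<mu>"
    by (rule compatible_if_continuous_ae)
  then have "\<mu> \<in> invariant_g_measures g"
    unfolding invariant_g_measures_def
    using prob_space_axioms sets_eq distr_shift by blast
  then show ?thesis by blast
qed

end
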